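(* Let $\mathcal{V}$ be a finite nonempty set, $L\ge 1$ an integer, and $\mathcal{S}=\mathcal{V}^L$. Let $(p_t)_{t\in[0,1]}$ and $(q_t)_{t\in[0,1]}$ be families of probability distributions on $\mathcal{S}$ with $p_0=q_0$, evolving according to the master (continuity) equations with velocity fields $u_t$ and $u_t^\theta$ respectively, and let $\Delta_t:=u_t^\theta-u_t$ be the velocity error. Let $\mu_{\mathrm{train}}$ and $\mu_{\mathrm{gen}}$ be the occupancies of $(p_t)$ and $(q_t)$ on $[0,1]\times\mathcal{S}$. Let $B\ge 0$ and let $\ell_\theta:[0,1]\times\mathcal{S}\to\mathbb{R}$ be a measurable (instantaneous loss) function with $0\le \ell_\theta\le B$. Then $$\mathbb{E}_{\mu_{\mathrm{gen}}}[\ell_\theta]\;\le\;\mathbb{E}_{\mu_{\mathrm{train}}}[\ell_\theta]+B\,\big\|\mu_{\mathrm{gen}}-\mu_{\mathrm{train}}\big\|_{\mathrm{TV}}$$ and $$\mathbb{E}_{\mu_{\mathrm{gen}}}[\ell_\theta]\;\le\;\mathbb{E}_{\mu_{\mathrm{train}}}[\ell_\theta]+B\int_0^1(1-t)\,\mathbb{E}_{x\sim q_t}\Big[\sum_{z\in\mathcal{S},\,z\ne x}|\Delta_t(x,z)|\Big]\,dt .$$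
   Context: Velocity fields: for each $t\in[0,1]$, $u_t,u_t^\theta:\mathcal{S}\times\mathcal{S}\to\mathbb{R}$, measurable in $t$, satisfy $u_t(x,z)\ge0$ and $u_t^\theta(x,z)\ge 0$ for $z\ne x$, and $u_t(x,x)=-\sum_{z\ne x}u_t(x,z)$, $u_t^\theta(x,x)=-\sum_{z\ne x}u_t^\theta(x,z)$. Here $u_t(x,z)$ is the instantaneous rate of probability flow from $x$ to $z$. Master equations: $t\mapsto p_t(x)$ and $t\mapsto q_t(x)$ are absolutely continuous on $[0,1]$ for each $x\in\mathcal{S}$, and for almost every $t\in[0,1]$ and all $x\in\mathcal{S}$, $$\dot p_t(x)=\sum_{z\ne x}\big[p_t(z)u_t(z,x)-p_t(x)u_t(x,z)\big],\qquad \dot q_t(x)=\sum_{z\ne x}\big[q_t(z)u^\theta_t(z,x)-q_t(x)u^\theta_t(x,z)\big].$$ Occupancies: with $\lambda$ the density of the uniform distribution on $[0,1]$ (so $\lambda\equiv1$), $\mu_{\mathrm{train}}$ and $\mu_{\mathrm{gen}}$ are the probability measures on $[0,1]\times\mathcal{S}$ with densities $\mu_{\mathrm{train}}(t,x)=\lambda(t)p_t(x)$ and $\mu_{\mathrm{gen}}(t,x)=\lambda(t)q_t(x)$ with respect to the product of Lebesgue measure and counting measure. (In the setting of interest, $p_t(x)=\sum_{x_0,x_1}\pi(x_0,x_1)p_t(x\mid x_0,x_1)$ for a coupling $\pi$ of source and data, and $q_t(x)=\sum_{x_0}p_0(x_0)q_t(x\mid x_0)$; only these marginals enter.) Total variation: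 for a signed measure with density $f$ with respect to a reference measure $\nu$, the norm $\|\cdot\|_{\mathrm{TV}}$ is $\tfrac12\int|f|\,d\nu$. Integrals of nonnegative functions may take the value $+\infty$; convention $0\cdot\infty=0$ is not needed when $B>0$, and for $B=0$ the right-hand extra term is read as $0$. *)

theory Defs
  imports "HOL-Probability.Probability"
begin

definition state_space :: "'v set \<Rightarrow> nat \<Rightarrow> (nat \<Rightarrow> 'v) set" where
  "state_space V L = {..<L} \<rightarrow>\<^sub>E V"

(* The usual epsilon-delta notion of an absolutely continuous function on [a, b]; the library's
   absolutely_continuous is the unrelated notion for pairs of measures. The family of
   non-overlapping subintervals is indexed by i < n. *)
definition absolutely_continuous_fun :: "real \<Rightarrow> real \<Rightarrow> (real \<Rightarrow> real) \<Rightarrow> bool" where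
  "absolutely_continuous_fun a b f \<longleftrightarrow>
    (\<forall>\<epsilon>>0. \<exists>\<delta>>0. \<forall>(n::nat) c d.
       (\<forall>i<n. a \<le> c i \<and> c i \<le> d i \<and> d i \<le> b) \<longrightarrow>
       disjoint_family_on (\<lambda>i. {c i<..<d i}) {..<n} \<longrightarrow>
       (\<Sum>i<n. d i - c i) < \<delta> \<longrightarrow>
       (\<Sum>i<n. \<bar>f (d i) - f (c i)\<bar>) < \<epsilon>)"

definition velocity_field :: "'s set \<Rightarrow> (real \<Rightarrow> 's \<Rightarrow> 's \<Rightarrow> real) \<Rightarrow> bool" where
  "velocity_field S u \<longleftrightarrow>
    (\<forall>x\<in>S. \<forall>z\<in>S. (\<lambda>t. u t x z) \<in> borel_measurable (lebesgue_on {0..1})) \<and>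
    (\<forall>t\<in>{0..1}. \<forall>x\<in>S. \<forall>z\<in>S. z \<noteq> x \<longrightarrow> 0 \<le> u t x z) \<and>
    (\<forall>t\<in>{0..1}. \<forall>x\<in>S. u t x x = - (\<Sum>z\<in>S - {x}. u t x z))"

definition master_equation ::
    "'s set \<Rightarrow> (real \<Rightarrow> 's pmf) \<Rightarrow> (real \<Rightarrow> 's \<Rightarrow> 's \<Rightarrow> real) \<Rightarrow> bool" where
  "master_equation S p u \<longleftrightarrow>
    (\<forall>x\<in>S. absolutely_continuous_fun 0 1 (\<lambda>t. pmf (p t) x)) \<and>
    (AE t in lebesgue_on {0..1}. \<forall>x\<in>S.
       ((\<lambda>s. pmf (p s) x) has_real_derivative
          (\<Sum>z\<in>S - {x}. pmf (p t) z * u t z x - pmf (p t) x * u t x z))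
       (at t within {0..1}))"

definition velocity_error ::
    "(real \<Rightarrow> 's \<Rightarrow> 's \<Rightarrow> real) \<Rightarrow> (real \<Rightarrow> 's \<Rightarrow> 's \<Rightarrow> real) \<Rightarrow> real \<Rightarrow> 's \<Rightarrow> 's \<Rightarrow> real" where
  "velocity_error u\<theta> u t x z = u\<theta> t x z - u t x z"

definition reference_measure :: "'s set \<Rightarrow> (real \<times> 's) measure" where
  "reference_measure S = lebesgue_on {0..1} \<Otimes>\<^sub>M count_space S"

(* The indicator is the density of the uniform distribution of the time on [0, 1]. *)
definition occupancy_density :: "(real \<Rightarrow> 's pmf) \<Rightarrow> real \<times> 's \<Rightarrow> real" where
  "occupancy_density p = (\<lambda>(t, x). indicat_real {0..1} t * pmf (p t) x)"

definition occupancy :: "'s set \<Rightarrow> (real \<Rightarrow> 's pmf) \<Rightarrow> (real \<times> 's) measure" where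
  "occupancy S p = density (reference_measure S) (\<lambda>w. ennreal (occupancy_density p w))"

(* Total variation norm, with the factor 1/2, of the signed measure with density f w.r.t. M.
   Signed measures have no library type, so the norm is a function of M and f. *)
definition tv_norm :: "'a measure \<Rightarrow> ('a \<Rightarrow> real) \<Rightarrow> ennreal" where
  "tv_norm M f = ennreal (1 / 2) * (\<integral>\<^sup>+ w. ennreal \<bar>f w\<bar> \<partial>M)"

end

theory Submission
  imports Defs
begin

text \<open>Since \<open>p\<close> and \<open>q\<close> have the same total mass, subtracting the constant \<open>B/2\<close> from the loss
  bounds the difference of expectations at each time by \<open>B\<close> times the total variation distance.
  That distance is absolutely continuous and vanishes at time \<open>0\<close>. Almost everywhere its growth rate
  is at most the expectation under \<open>q\<close> of the velocity error, because the common part of the two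
  flows contracts the \<open>l\<^sup>1\<close> norm. Integrating the resulting bound over \<open>0 \<le> s \<le> t \<le> 1\<close> and exchanging
  the integrals produces the weight \<open>1 - s\<close>.\<close>

text \<open>The distance is never differentiated: where \<open>q - p\<close> vanishes in some state,
  its absolute value can have a corner, and a derivative known almost everywhere would still have to
  be integrated back. Instead each good time \<open>t\<close> carries a bound on straddling
  increments, \<open>T w - T v \<le> (g t + e) * (w - v)\<close> for
  \<open>v \<le> t \<le> w\<close> close to \<open>t\<close>. Such a bound survives corners, adds up
  over the states, and is exactly what the pieces of a tagged division sum.

  The error is weighted by \<open>q\<close>, without a Gronwall factor, because the flows are
  compared through \<open>q u' - p u = (q - p) u + q (u' - u)\<close>: the field \<open>u\<close>
  acts on the difference alone. Each rate error then occurs twice, as outflow of one state and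
  inflow of another, and this factor 2 cancels the 1/2 in the total variation.

  The rates are only measurable, so the integral of the error may be infinite; the integrated
  estimates therefore live in \<open>ennreal\<close>.\<close>

section \<open>Absolutely continuous functions\<close>

text \<open>The definition numbers the intervals by naturals, but their order is immaterial.
  Arbitrary finite index sets allow the pieces of a tagged division to index themselves.\<close>

lemma absolutely_continuous_funD:
  fixes I :: "'i set"
  assumes "absolutely_continuous_fun a b f" "0 < \<epsilon>"
  obtains \<delta> where "0 < \<delta>"
    "\<And>(I :: 'i set) c d. finite I \<Longrightarrow> (\<And>i. i \<in> I \<Longrightarrow> a \<le> c i \<and> c i \<le> d i \<and> d i \<le> b) \<Longrightarrow>
       disjoint_family_on (\<lambda>i. {c i<..<d i}) I \<Longrightarrow> (\<Sum>i\<in>I. d i - c i) < \<delta> \<Longrightarrow>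
       (\<Sum>i\<in>I. \<bar>f (d i) - f (c i)\<bar>) < \<epsilon>"
proof -
  obtain \<delta> where "0 < \<delta>" and \<delta>: "\<And>(n::nat) c d.
       (\<forall>i<n. a \<le> c i \<and> c i \<le> d i \<and> d i \<le> b) \<Longrightarrow>
       disjoint_family_on (\<lambda>i. {c i<..<d i}) {..<n} \<Longrightarrow>
       (\<Sum>i<n. d i - c i) < \<delta> \<Longrightarrow>
       (\<Sum>i<n. \<bar>f (d i) - f (c i)\<bar>) < \<epsilon>"
    using assms unfolding absolutely_continuous_fun_def by meson
  show thesis
  proof (rule that [OF \<open>0 < \<delta>\<close>])
    fix I :: "'i set" and c d
    assume I: "finite I" and cd: "\<And>i. i \<in> I \<Longrightarrow> a \<le> c i \<and> c i \<le> d i \<and> d i \<le> b"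
      and disj: "disjoint_family_on (\<lambda>i. {c i<..<d i}) I" and small: "(\<Sum>i\<in>I. d i - c i) < \<delta>"
    obtain h where h: "bij_betw h {..<card I} I"
      using ex_bij_betw_nat_finite [OF I] by (auto simp: atLeast0LessThan)
    have hI: "h i \<in> I" if "i < card I" for i
      using h that by (auto simp: bij_betw_def)
    have "(\<Sum>i<card I. \<bar>f ((d \<circ> h) i) - f ((c \<circ> h) i)\<bar>) < \<epsilon>"
    proof (rule \<delta>)
      show "\<forall>i<card I. a \<le> (c \<circ> h) i \<and> (c \<circ> h) i \<le> (d \<circ> h) i \<and> (d \<circ> h) i \<le> b"
        using cd hI by simp
      show "disjoint_family_on (\<lambda>i. {(c \<circ> h) i<..<(d \<circ> h) i}) {..<card I}"
        unfolding disjoint_family_on_def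
      proof (intro ballI impI)
        fix m n assume mn: "m \<in> {..<card I}" "n \<in> {..<card I}" "m \<noteq> n"
        then have "h m \<noteq> h n"
          using h by (auto simp: bij_betw_def inj_on_def)
        then show "{(c \<circ> h) m<..<(d \<circ> h) m} \<inter> {(c \<circ> h) n<..<(d \<circ> h) n} = {}"
          using disj hI mn unfolding disjoint_family_on_def by (metis comp_apply lessThan_iff)
      qed
      show "(\<Sum>i<card I. (d \<circ> h) i - (c \<circ> h) i) < \<delta>"
        using small sum.reindex_bij_betw [OF h, of "\<lambda>i. d i - c i"] by simp
    qed
    then show "(\<Sum>i\<in>I. \<bar>f (d i) - f (c i)\<bar>) < \<epsilon>"
      using sum.reindex_bij_betw [OF h, of "\<lambda>i. \<bar>f (d i) - f (c i)\<bar>"] by simp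
  qed
qed

text \<open>One domination criterion serves both for adding a summand and for the map
  \<open>1 / 2 * \<bar>q - p\<bar>\<close>.\<close>

lemma absolutely_continuous_fun_le_add:
  assumes f: "absolutely_continuous_fun a b f" and g: "absolutely_continuous_fun a b g"
    and le: "\<And>s t. s \<in> {a..b} \<Longrightarrow> t \<in> {a..b} \<Longrightarrow> \<bar>h t - h s\<bar> \<le> \<bar>f t - f s\<bar> + \<bar>g t - g s\<bar>"
  shows "absolutely_continuous_fun a b h"
  unfolding absolutely_continuous_fun_def
proof (intro allI impI)
  fix \<epsilon> :: real assume "0 < \<epsilon>"
  then have e: "0 < \<epsilon> / 2" by simp
  obtain \<delta>1 where "0 < \<delta>1" and d1: "\<And>(I::nat set) c d. finite I \<Longrightarrow> (\<And>i. i \<in> I \<Longrightarrow> a \<le> c i \<and> c i \<le> d i \<and> d i \<le> b) \<Longrightarrow>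
       disjoint_family_on (\<lambda>i. {c i<..<d i}) I \<Longrightarrow> (\<Sum>i\<in>I. d i - c i) < \<delta>1 \<Longrightarrow>
       (\<Sum>i\<in>I. \<bar>f (d i) - f (c i)\<bar>) < \<epsilon> / 2"
    using absolutely_continuous_funD [OF f e] by blast
  obtain \<delta>2 where "0 < \<delta>2" and d2: "\<And>(I::nat set) c d. finite I \<Longrightarrow> (\<And>i. i \<in> I \<Longrightarrow> a \<le> c i \<and> c i \<le> d i \<and> d i \<le> b) \<Longrightarrow>
       disjoint_family_on (\<lambda>i. {c i<..<d i}) I \<Longrightarrow> (\<Sum>i\<in>I. d i - c i) < \<delta>2 \<Longrightarrow>
       (\<Sum>i\<in>I. \<bar>g (d i) - g (c i)\<bar>) < \<epsilon> / 2"
    using absolutely_continuous_funD [OF g e] by blast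
  show "\<exists>\<delta>>0. \<forall>(n::nat) c d.
       (\<forall>i<n. a \<le> c i \<and> c i \<le> d i \<and> d i \<le> b) \<longrightarrow>
       disjoint_family_on (\<lambda>i. {c i<..<d i}) {..<n} \<longrightarrow>
       (\<Sum>i<n. d i - c i) < \<delta> \<longrightarrow>
       (\<Sum>i<n. \<bar>h (d i) - h (c i)\<bar>) < \<epsilon>"
  proof (intro exI [of _ "min \<delta>1 \<delta>2"] conjI allI impI)
    fix n :: nat and c d
    assume cd: "\<forall>i<n. a \<le> c i \<and> c i \<le> d i \<and> d i \<le> b"
      and disj: "disjoint_family_on (\<lambda>i. {c i<..<d i}) {..<n}"
      and small: "(\<Sum>i<n. d i - c i) < min \<delta>1 \<delta>2"
    have "(\<Sum>i<n. \<bar>h (d i) - h (c i)\<bar>) \<le> (\<Sum>i<n. \<bar>f (d i) - f (c i)\<bar> + \<bar>g (d i) - g (c i)\<bar>)"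
      using cd by (intro sum_mono le) force+
    also have "\<dots> = (\<Sum>i<n. \<bar>f (d i) - f (c i)\<bar>) + (\<Sum>i<n. \<bar>g (d i) - g (c i)\<bar>)"
      by (rule sum.distrib)
    also have "\<dots> < \<epsilon> / 2 + \<epsilon> / 2"
      using cd disj small by (intro add_strict_mono d1 d2) auto
    finally show "(\<Sum>i<n. \<bar>h (d i) - h (c i)\<bar>) < \<epsilon>" by simp
  qed (use \<open>0 < \<delta>1\<close> \<open>0 < \<delta>2\<close> in simp)
qed

lemma absolutely_continuous_fun_const: "absolutely_continuous_fun a b (\<lambda>t. k)"
  by (auto simp: absolutely_continuous_fun_def intro!: exI [of _ 1])

lemma absolutely_continuous_fun_sum:
  assumes "finite I" "\<And>i. i \<in> I \<Longrightarrow> absolutely_continuous_fun a b (f i)"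
  shows "absolutely_continuous_fun a b (\<lambda>t. \<Sum>i\<in>I. f i t)"
  using assms
proof (induction I rule: finite_induct)
  case (insert j I)
  show ?case
  proof (rule absolutely_continuous_fun_le_add)
    show "absolutely_continuous_fun a b (f j)"
      using insert.prems by simp
    show "absolutely_continuous_fun a b (\<lambda>t. \<Sum>i\<in>I. f i t)"
      using insert by simp
  qed (use insert.hyps in simp)
qed (simp add: absolutely_continuous_fun_const)

lemma absolutely_continuous_fun_subinterval:
  assumes "absolutely_continuous_fun a b f" "a \<le> a'" "b' \<le> b"
  shows "absolutely_continuous_fun a' b' f"
  unfolding absolutely_continuous_fun_def
proof (intro allI impI)
  fix \<epsilon> :: real assume "0 < \<epsilon>"
  obtain \<delta> where "0 < \<delta>" and \<delta>: "\<And>(I::nat set) c d. finite I \<Longrightarrow> (\<And>i. i \<in> I \<Longrightarrow> a \<le> c i \<and> c i \<le> d i \<and> d i \<le> b) \<Longrightarrow>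
       disjoint_family_on (\<lambda>i. {c i<..<d i}) I \<Longrightarrow> (\<Sum>i\<in>I. d i - c i) < \<delta> \<Longrightarrow>
       (\<Sum>i\<in>I. \<bar>f (d i) - f (c i)\<bar>) < \<epsilon>"
    using absolutely_continuous_funD [OF assms(1) \<open>0 < \<epsilon>\<close>] by blast
  show "\<exists>\<delta>>0. \<forall>(n::nat) c d.
       (\<forall>i<n. a' \<le> c i \<and> c i \<le> d i \<and> d i \<le> b') \<longrightarrow>
       disjoint_family_on (\<lambda>i. {c i<..<d i}) {..<n} \<longrightarrow>
       (\<Sum>i<n. d i - c i) < \<delta> \<longrightarrow>
       (\<Sum>i<n. \<bar>f (d i) - f (c i)\<bar>) < \<epsilon>"
    using assms(2,3) by (intro exI [of _ \<delta>] conjI allI impI \<open>0 < \<delta>\<close> \<delta>) force+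
qed

text \<open>The single interval between \<open>x\<close> and \<open>y\<close> is a disjoint family,
  indexed here by \<open>unit\<close>. Continuity is what makes the probabilities measurable in
  time.\<close>

lemma absolutely_continuous_fun_imp_continuous_on:
  assumes f: "absolutely_continuous_fun a b f"
  shows "continuous_on {a..b} f"
  unfolding continuous_on_iff
proof (intro ballI allI impI)
  fix x \<epsilon> :: real assume x: "x \<in> {a..b}" and "0 < \<epsilon>"
  obtain \<delta> where "0 < \<delta>" and \<delta>: "\<And>(I::unit set) c d. finite I \<Longrightarrow> (\<And>i. i \<in> I \<Longrightarrow> a \<le> c i \<and> c i \<le> d i \<and> d i \<le> b) \<Longrightarrow>
       disjoint_family_on (\<lambda>i. {c i<..<d i}) I \<Longrightarrow> (\<Sum>i\<in>I. d i - c i) < \<delta> \<Longrightarrow>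
       (\<Sum>i\<in>I. \<bar>f (d i) - f (c i)\<bar>) < \<epsilon>"
    using absolutely_continuous_funD [OF f \<open>0 < \<epsilon>\<close>] by blast
  show "\<exists>\<delta>>0. \<forall>y\<in>{a..b}. dist y x < \<delta> \<longrightarrow> dist (f y) (f x) < \<epsilon>"
  proof (intro exI [of _ \<delta>] conjI ballI impI \<open>0 < \<delta>\<close>)
    fix y assume "y \<in> {a..b}" "dist y x < \<delta>"
    then show "dist (f y) (f x) < \<epsilon>"
      using \<delta> [of "{()}" "\<lambda>_. min x y" "\<lambda>_. max x y"] x
      by (auto simp: disjoint_family_on_def dist_real_def min_def max_def abs_if split: if_splits)
  qed
qed

section \<open>From local increments to the integral\<close>

text \<open>A Henstock--Kurzweil argument: the gauge is given by the local increment bound off the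
  exceptional set, and by an open cover of small measure on it, where absolute continuity applies.\<close>

lemma absolutely_continuous_fun_increment_le:
  fixes f G :: "real \<Rightarrow> real"
  assumes "a \<le> b" and f: "absolutely_continuous_fun a b f" and N: "negligible N"
    and G: "G integrable_on {a..b}"
    and loc: "\<And>t e. t \<in> {a..b} - N \<Longrightarrow> 0 < e \<Longrightarrow>
      \<exists>r>0. \<forall>v w. a \<le> v \<and> v \<le> t \<and> t \<le> w \<and> w \<le> b \<and> t - v < r \<and> w - t < r \<longrightarrow>
        f w - f v \<le> (G t + e) * (w - v)"
  shows "f b - f a \<le> integral {a..b} G"
proof (rule field_le_epsilon)
  fix e0 :: real assume "0 < e0"
  \<comment> \<open>Three errors have to fit into \<open>e0\<close>: \<open>e * (b - a)\<close> from
    the local slopes, \<open>e\<close> from the Riemann sum, and \<open>e\<close> from the tags in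
    \<open>N\<close>. The \<open>2\<close> also keeps the denominator positive when
    \<open>a = b\<close>.\<close>
  define e where "e = e0 / (b - a + 2)"
  have "0 < e"
    using \<open>0 < e0\<close> \<open>a \<le> b\<close> by (simp add: e_def)
  have "e * (b - a + 2) = e0"
    using \<open>a \<le> b\<close> by (simp add: e_def)
  then have e_eq: "e * (b - a) + 2 * e = e0"
    by (simp add: algebra_simps)
  \<comment> \<open>Nothing is known about \<open>G\<close> on \<open>N\<close>, where it may be
    very negative. The value 0 leaves the integral unchanged and makes the slope term of such a tag
    nonnegative, so that absolute continuity alone pays for its increment.\<close>
  define G0 where "G0 t = (if t \<in> N then 0 else G t)" for t
  have "(G0 has_integral integral {a..b} G) {a..b}"
    by (rule has_integral_spike [OF N _ integrable_integral [OF G]]) (auto simp: G0_def)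
  then obtain \<gamma>1 where "gauge \<gamma>1" and \<gamma>1: "\<And>\<D>. \<D> tagged_division_of {a..b} \<Longrightarrow> \<gamma>1 fine \<D> \<Longrightarrow>
      norm ((\<Sum>(x,K)\<in>\<D>. measure lborel K *\<^sub>R G0 x) - integral {a..b} G) < e"
    using \<open>0 < e\<close> unfolding has_integral_real by meson
  obtain \<delta> where "0 < \<delta>" and \<delta>: "\<And>(I :: (real \<times> real set) set) c d. finite I \<Longrightarrow>
       (\<And>i. i \<in> I \<Longrightarrow> a \<le> c i \<and> c i \<le> d i \<and> d i \<le> b) \<Longrightarrow>
       disjoint_family_on (\<lambda>i. {c i<..<d i}) I \<Longrightarrow> (\<Sum>i\<in>I. d i - c i) < \<delta> \<Longrightarrow>
       (\<Sum>i\<in>I. \<bar>f (d i) - f (c i)\<bar>) < e"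
    using absolutely_continuous_funD [OF f \<open>0 < e\<close>] by blast
  have N_null: "N \<in> null_sets lebesgue"
    using N by (simp add: negligible_iff_null_sets)
  then have N_sets: "N \<in> sets lebesgue" by auto
  obtain U where "open U" "N \<subseteq> U" and U: "emeasure lebesgue (U - N) < ennreal \<delta>"
    using sets_lebesgue_outer_open [OF N_sets \<open>0 < \<delta>\<close>] by metis
  have U_small: "emeasure lebesgue U < ennreal \<delta>"
    using U emeasure_Diff_null_set [OF N_null, of U] \<open>open U\<close> by (simp add: borel_open)
  obtain r where r_pos: "\<And>t. t \<in> {a..b} - N \<Longrightarrow> 0 < r t"
    and r: "\<And>t v w. t \<in> {a..b} - N \<Longrightarrow> a \<le> v \<Longrightarrow> v \<le> t \<Longrightarrow> t \<le> w \<Longrightarrow> w \<le> b \<Longrightarrow> t - v < r t \<Longrightarrow> w - t < r t \<Longrightarrow>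
        f w - f v \<le> (G t + e) * (w - v)"
    using loc [OF _ \<open>0 < e\<close>] by metis
  \<comment> \<open>\<open>UNIV\<close> is a default value: all tags lie in
    \<open>{a..b}\<close>.\<close>
  define \<gamma>2 where "\<gamma>2 t = (if t \<in> N then U else if t \<in> {a..b} then ball t (r t) else UNIV)" for t
  have "gauge \<gamma>2"
    using \<open>open U\<close> \<open>N \<subseteq> U\<close> r_pos by (auto simp: gauge_def \<gamma>2_def)
  then obtain \<D> where D: "\<D> tagged_division_of {a..b}" and "(\<lambda>x. \<gamma>1 x \<inter> \<gamma>2 x) fine \<D>"
    using fine_division_exists_real [OF gauge_Int [OF \<open>gauge \<gamma>1\<close>]] by metis
  then have fine1: "\<gamma>1 fine \<D>" and fine2: "\<gamma>2 fine \<D>"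
    by (auto simp: fine_Int)
  note Dprop = tagged_division_ofD [OF D]
  have "finite \<D>" by (rule Dprop(1))
  have ivl: "\<exists>v w. K = {v..w} \<and> Inf K = v \<and> Sup K = w \<and> a \<le> v \<and> v \<le> t \<and> t \<le> w \<and> w \<le> b"
    if tK: "(t, K) \<in> \<D>" for t K
  proof -
    obtain v w where K: "K = {v..w}" using Dprop(4) [OF tK] by auto
    have "t \<in> K" "K \<subseteq> {a..b}" using Dprop(2,3) [OF tK] by auto
    then show ?thesis using K by (intro exI [of _ v] exI [of _ w]) auto
  qed
  define DN where "DN = {i \<in> \<D>. fst i \<in> N}"
  define lo where "lo i = Inf (snd i)" for i :: "real \<times> real set"
  define hi where "hi i = Sup (snd i)" for i :: "real \<times> real set"
  have DN_sub: "DN \<subseteq> \<D>" and "finite DN"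
    using \<open>finite \<D>\<close> by (auto simp: DN_def)
  have lohi: "a \<le> lo i \<and> lo i \<le> fst i \<and> fst i \<le> hi i \<and> hi i \<le> b \<and> snd i = {lo i..hi i}"
    if "i \<in> \<D>" for i
    using ivl [of "fst i" "snd i"] that by (auto simp: lo_def hi_def)
  have len: "measure lborel (snd i) = hi i - lo i" if "i \<in> \<D>" for i
    using lohi [OF that] by simp
  have lo_hi: "lo i \<le> hi i" if "i \<in> DN" for i
    using lohi [of i] that DN_sub by fastforce
  have disj: "disjoint_family_on (\<lambda>i. {lo i<..<hi i}) DN"
    unfolding disjoint_family_on_def
  proof (intro ballI impI)
    fix i j assume ij: "i \<in> DN" "j \<in> DN" "i \<noteq> j"
    then have "interior (snd i) \<inter> interior (snd j) = {}"
      using Dprop(5) [of "fst i" "snd i" "fst j" "snd j"] DN_sub by auto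
    moreover have "interior (snd i) = {lo i<..<hi i}" "interior (snd j) = {lo j<..<hi j}"
      using lohi ij DN_sub by (metis interior_atLeastAtMost_real subsetD)+
    ultimately show "{lo i<..<hi i} \<inter> {lo j<..<hi j} = {}" by simp
  qed
  \<comment> \<open>Neighbouring closed pieces share end points, so their interiors are measured:
    these are disjoint subsets of \<open>U\<close>, and their lengths sum to less than
    \<open>\<delta>\<close>.\<close>
  have "ennreal (\<Sum>i\<in>DN. hi i - lo i) = (\<Sum>i\<in>DN. emeasure lebesgue {lo i<..<hi i})"
    using lo_hi by (subst sum_ennreal [symmetric]) (auto intro: sum.cong)
  also have "\<dots> = emeasure lebesgue (\<Union>i\<in>DN. {lo i<..<hi i})"
    by (rule sum_emeasure) (use disj \<open>finite DN\<close> in auto)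
  also have "\<dots> \<le> emeasure lebesgue U"
  proof (rule emeasure_mono)
    have "{lo i<..<hi i} \<subseteq> U" if "i \<in> DN" for i
    proof -
      have "snd i \<subseteq> \<gamma>2 (fst i)"
        using that DN_sub by (intro fineD [OF fine2]) auto
      moreover have "{lo i<..<hi i} \<subseteq> snd i"
        using lohi [of i] that DN_sub by auto
      ultimately show ?thesis using that by (auto simp: DN_def \<gamma>2_def)
    qed
    then show "(\<Union>i\<in>DN. {lo i<..<hi i}) \<subseteq> U" by blast
    show "U \<in> sets lebesgue" using \<open>open U\<close> by (simp add: borel_open)
  qed
  also note U_small
  finally have DN_small: "(\<Sum>i\<in>DN. hi i - lo i) < \<delta>"
    using lo_hi by (simp add: ennreal_less_iff sum_nonneg)
  have DN_le: "(\<Sum>i\<in>DN. \<bar>f (hi i) - f (lo i)\<bar>) < e"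
  proof (rule \<delta> [OF \<open>finite DN\<close> _ disj DN_small])
    show "a \<le> lo i \<and> lo i \<le> hi i \<and> hi i \<le> b" if "i \<in> DN" for i
      using lohi [of i] that DN_sub by fastforce
  qed
  \<comment> \<open>The telescoping is stated for every \<open>g\<close>, as it is used for
    \<open>f\<close> and, to get the total length \<open>b - a\<close>, for the identity.\<close>
  have total: "(\<Sum>i\<in>\<D>. g (hi i) - g (lo i)) = g b - g a" for g :: "real \<Rightarrow> real"
    using additive_tagged_division_1 [OF \<open>a \<le> b\<close> D, of g] by (simp add: lo_def hi_def split_beta)
  have "f b - f a = (\<Sum>i\<in>\<D>. f (hi i) - f (lo i))"
    by (simp add: total)
  also have "\<dots> \<le> (\<Sum>i\<in>\<D>. (G0 (fst i) + e) * (hi i - lo i)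
      + (if i \<in> DN then \<bar>f (hi i) - f (lo i)\<bar> else 0))"
  proof (rule sum_mono)
    fix i assume i: "i \<in> \<D>"
    show "f (hi i) - f (lo i) \<le> (G0 (fst i) + e) * (hi i - lo i)
      + (if i \<in> DN then \<bar>f (hi i) - f (lo i)\<bar> else 0)"
    proof (cases "i \<in> DN")
      case True
      then have "(G0 (fst i) + e) * (hi i - lo i) \<ge> 0"
        using lohi [OF i] \<open>0 < e\<close> by (auto simp: G0_def DN_def)
      then show ?thesis using True by simp
    next
      case False
      then have nN: "fst i \<notin> N" using i by (auto simp: DN_def)
      have "snd i \<subseteq> \<gamma>2 (fst i)"
        using i by (intro fineD [OF fine2]) auto
      then have sub: "{lo i..hi i} \<subseteq> ball (fst i) (r (fst i))"
        using nN lohi [OF i] by (auto simp: \<gamma>2_def split: if_splits)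
      have "lo i \<in> ball (fst i) (r (fst i))" "hi i \<in> ball (fst i) (r (fst i))"
        using lohi [OF i] subsetD [OF sub, of "lo i"] subsetD [OF sub, of "hi i"] by simp_all
      then have "f (hi i) - f (lo i) \<le> (G (fst i) + e) * (hi i - lo i)"
        using lohi [OF i] nN by (intro r) (auto simp: dist_real_def)
      then show ?thesis using False nN by (simp add: G0_def)
    qed
  qed
  also have "\<dots> = (\<Sum>i\<in>\<D>. measure lborel (snd i) * G0 (fst i)) + e * (\<Sum>i\<in>\<D>. hi i - lo i)
      + (\<Sum>i\<in>DN. \<bar>f (hi i) - f (lo i)\<bar>)"
  proof -
    have "(\<Sum>i\<in>\<D>. if i \<in> DN then \<bar>f (hi i) - f (lo i)\<bar> else 0) = (\<Sum>i\<in>DN. \<bar>f (hi i) - f (lo i)\<bar>)"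
      using DN_sub \<open>finite \<D>\<close> by (simp add: sum.inter_restrict [symmetric] Int_absorb1)
    moreover have "(\<Sum>i\<in>\<D>. (G0 (fst i) + e) * (hi i - lo i))
        = (\<Sum>i\<in>\<D>. measure lborel (snd i) * G0 (fst i) + e * (hi i - lo i))"
      by (rule sum.cong) (auto simp: len algebra_simps)
    ultimately show ?thesis by (simp add: sum.distrib sum_distrib_left)
  qed
  also have "\<dots> \<le> (integral {a..b} G + e) + e * (b - a) + e"
  proof -
    have "(\<Sum>i\<in>\<D>. measure lborel (snd i) * G0 (fst i)) \<le> integral {a..b} G + e"
      using \<gamma>1 [OF D fine1] by (simp add: split_beta real_norm_def)
    then show ?thesis using DN_le total [of "\<lambda>x. x"] by simp
  qed
  finally show "f b - f a \<le> integral {a..b} G + e0"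
    using e_eq by simp
qed

section \<open>Local increments of absolute values and of finite sums\<close>

text \<open>If \<open>e t \<noteq> 0\<close>, then \<open>e\<close> keeps its sign near
  \<open>t\<close> and \<open>\<bar>e\<bar>\<close> is \<open>s * e\<close> there. At a zero,
  \<open>\<bar>e\<bar>\<close> grows by at most \<open>\<bar>e w - e v\<bar>\<close>, which is about
  \<open>\<bar>D\<bar> * (w - v)\<close>, and the third condition on \<open>s\<close> turns this
  into \<open>s * D\<close>. Only an upper bound is claimed, so a corner does no harm.\<close>

lemma abs_local_increment_le:
  fixes e :: "real \<Rightarrow> real"
  assumes D: "(e has_real_derivative D) (at t within {a..b})"
    and s: "\<bar>s\<bar> = 1" "s * e t = \<bar>e t\<bar>" "e t = 0 \<Longrightarrow> s * D = \<bar>D\<bar>"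
    and "0 < \<epsilon>"
  shows "\<exists>r>0. \<forall>v w. a \<le> v \<and> v \<le> t \<and> t \<le> w \<and> w \<le> b \<and> t - v < r \<and> w - t < r \<longrightarrow>
    \<bar>e w\<bar> - \<bar>e v\<bar> \<le> (s * D + \<epsilon>) * (w - v)"
proof -
  obtain r1 where "0 < r1" and r1: "\<And>y. y \<in> {a..b} \<Longrightarrow> \<bar>y - t\<bar> < r1 \<Longrightarrow> \<bar>e y - e t - D * (y - t)\<bar> \<le> \<epsilon> * \<bar>y - t\<bar>"
    using D \<open>0 < \<epsilon>\<close> unfolding has_field_derivative_def has_derivative_within_alt real_norm_def by meson
  \<comment> \<open>Because \<open>t\<close> lies between \<open>v\<close> and \<open>w\<close>, the
    errors \<open>\<epsilon> * (t - v)\<close> and \<open>\<epsilon> * (w - t)\<close> add up to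
    exactly \<open>\<epsilon> * (w - v)\<close>.\<close>
  have straddle: "\<bar>e w - e v - D * (w - v)\<bar> \<le> \<epsilon> * (w - v)"
    if "a \<le> v" "v \<le> t" "t \<le> w" "w \<le> b" "t - v < r1" "w - t < r1" for v w
    using r1 [of v] r1 [of w] that by (auto simp: abs_le_iff algebra_simps)
  show ?thesis
  proof (cases "e t = 0")
    case True
    have "\<bar>e w\<bar> - \<bar>e v\<bar> \<le> (s * D + \<epsilon>) * (w - v)"
      if "a \<le> v" "v \<le> t" "t \<le> w" "w \<le> b" "t - v < r1" "w - t < r1" for v w
    proof -
      have "\<bar>e w\<bar> - \<bar>e v\<bar> \<le> \<bar>D * (w - v)\<bar> + \<epsilon> * (w - v)"
        using straddle [OF that] by linarith
      then show ?thesis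
        using that s(3) [OF True] by (simp add: abs_mult distrib_right)
    qed
    then show ?thesis using \<open>0 < r1\<close> by blast
  next
    case False
    have "continuous (at t within {a..b}) e"
      using D by (rule DERIV_continuous)
    then obtain r2 where "0 < r2" and r2: "\<And>y. y \<in> {a..b} \<Longrightarrow> \<bar>y - t\<bar> < r2 \<Longrightarrow> \<bar>e y - e t\<bar> < \<bar>e t\<bar>"
      using False unfolding continuous_within_eps_delta dist_real_def by (metis zero_less_abs_iff)
    have s_cases: "s = 1 \<or> s = - 1" using s(1) by linarith
    have sgn: "\<bar>e y\<bar> = s * e y" if "y \<in> {a..b}" "\<bar>y - t\<bar> < r2" for y
      using r2 [OF that] s(2) s_cases by (auto simp: abs_if split: if_splits)
    have "\<bar>e w\<bar> - \<bar>e v\<bar> \<le> (s * D + \<epsilon>) * (w - v)"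
      if vw: "a \<le> v" "v \<le> t" "t \<le> w" "w \<le> b" "t - v < min r1 r2" "w - t < min r1 r2" for v w
    proof -
      have "\<bar>e w\<bar> - \<bar>e v\<bar> = s * (e w - e v)"
        using sgn [of v] sgn [of w] vw by (simp add: algebra_simps)
      also have "\<dots> \<le> s * (D * (w - v)) + \<epsilon> * (w - v)"
        using straddle [of v w] vw s_cases by auto
      finally show ?thesis by (simp add: algebra_simps)
    qed
    then show ?thesis using \<open>0 < r1\<close> \<open>0 < r2\<close> by (intro exI [of _ "min r1 r2"]) auto
  qed
qed

text \<open>Each insertion shares the slack between the new term and the old sum and takes the
  smaller radius.\<close>

lemma sum_local_increment_le:
  fixes f D :: "'i \<Rightarrow> real \<Rightarrow> real"
  assumes "finite I"
    and f: "\<And>i e. i \<in> I \<Longrightarrow> 0 < e \<Longrightarrow>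
      \<exists>r>0. \<forall>v w. a \<le> v \<and> v \<le> t \<and> t \<le> w \<and> w \<le> b \<and> t - v < r \<and> w - t < r \<longrightarrow>
        f i w - f i v \<le> (D i t + e) * (w - v)"
    and "0 < \<epsilon>"
  shows "\<exists>r>0. \<forall>v w. a \<le> v \<and> v \<le> t \<and> t \<le> w \<and> w \<le> b \<and> t - v < r \<and> w - t < r \<longrightarrow>
    (\<Sum>i\<in>I. f i w) - (\<Sum>i\<in>I. f i v) \<le> ((\<Sum>i\<in>I. D i t) + \<epsilon>) * (w - v)"
  using assms
proof (induction I arbitrary: \<epsilon> rule: finite_induct)
  case empty
  then show ?case by (intro exI [of _ 1]) auto
next
  case (insert j I)
  have e: "0 < \<epsilon> / 2" using insert.prems by simp
  obtain r1 where "0 < r1" and r1: "\<And>v w. a \<le> v \<and> v \<le> t \<and> t \<le> w \<and> w \<le> b \<and> t - v < r1 \<and> w - t < r1 \<Longrightarrow>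
        f j w - f j v \<le> (D j t + \<epsilon> / 2) * (w - v)"
    using insert.prems(1) [of j, OF _ e] by auto
  have "\<exists>r>0. \<forall>v w. a \<le> v \<and> v \<le> t \<and> t \<le> w \<and> w \<le> b \<and> t - v < r \<and> w - t < r \<longrightarrow>
    (\<Sum>i\<in>I. f i w) - (\<Sum>i\<in>I. f i v) \<le> ((\<Sum>i\<in>I. D i t) + \<epsilon> / 2) * (w - v)"
    by (rule insert.IH [OF _ e]) (rule insert.prems(1), auto)
  then obtain r2 where "0 < r2" and r2: "\<And>v w. a \<le> v \<and> v \<le> t \<and> t \<le> w \<and> w \<le> b \<and> t - v < r2 \<and> w - t < r2 \<Longrightarrow>
    (\<Sum>i\<in>I. f i w) - (\<Sum>i\<in>I. f i v) \<le> ((\<Sum>i\<in>I. D i t) + \<epsilon> / 2) * (w - v)"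
    by blast
  show ?case
  proof (intro exI [of _ "min r1 r2"] conjI allI impI)
    fix v w assume "a \<le> v \<and> v \<le> t \<and> t \<le> w \<and> w \<le> b \<and> t - v < min r1 r2 \<and> w - t < min r1 r2"
    then have "(f j w - f j v) + ((\<Sum>i\<in>I. f i w) - (\<Sum>i\<in>I. f i v))
        \<le> (D j t + \<epsilon> / 2) * (w - v) + ((\<Sum>i\<in>I. D i t) + \<epsilon> / 2) * (w - v)"
      by (intro add_mono r1 r2) auto
    also have "\<dots> = (D j t + (\<Sum>i\<in>I. D i t) + \<epsilon>) * (w - v)"
      by (simp add: field_simps)
    finally show "(\<Sum>i\<in>insert j I. f i w) - (\<Sum>i\<in>insert j I. f i v)
        \<le> ((\<Sum>i\<in>insert j I. D i t) + \<epsilon>) * (w - v)"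
      using insert.hyps by simp
  qed (use \<open>0 < r1\<close> \<open>0 < r2\<close> in simp)
qed

section \<open>Estimates at a fixed time\<close>

text \<open>Both sides run over the ordered pairs of distinct states. This is the bookkeeping of
  mass conservation: what leaves one state enters another.\<close>

lemma sum_off_diagonal_swap:
  assumes "finite S"
  shows "(\<Sum>x\<in>S. \<Sum>z\<in>S - {x}. f x z) = (\<Sum>x\<in>S. \<Sum>z\<in>S - {x}. f z x)"
proof -
  have "S - {x} = {z \<in> S. x \<noteq> z}" "S - {x} = {z \<in> S. z \<noteq> x}" for x by auto
  then show ?thesis
    using sum.swap_restrict [OF assms assms, of f "(\<noteq>)"] by simp
qed

text \<open>Testing the difference of the two master equations against a sign of \<open>q - p\<close>: the part driven
  by the common field is dissipative, since each of its rates counts once as inflow and once as outflow.\<close>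

lemma master_equation_sign_le:
  fixes p q s :: "'s \<Rightarrow> real"
  assumes "finite S"
    and u: "\<And>x z. x \<in> S \<Longrightarrow> z \<in> S \<Longrightarrow> z \<noteq> x \<Longrightarrow> 0 \<le> u x z"
    and q: "\<And>x. x \<in> S \<Longrightarrow> 0 \<le> q x"
    and s: "\<And>x. x \<in> S \<Longrightarrow> \<bar>s x\<bar> = 1" "\<And>x. x \<in> S \<Longrightarrow> s x * (q x - p x) = \<bar>q x - p x\<bar>"
  shows "(\<Sum>x\<in>S. s x * ((\<Sum>z\<in>S - {x}. q z * u' z x - q x * u' x z)
                     - (\<Sum>z\<in>S - {x}. p z * u z x - p x * u x z)))
    \<le> 2 * (\<Sum>x\<in>S. q x * (\<Sum>z\<in>S - {x}. \<bar>u' x z - u x z\<bar>))"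
proof -
  define e where "e x = q x - p x" for x
  define \<Delta> where "\<Delta> x z = \<bar>u' x z - u x z\<bar>" for x z
  \<comment> \<open>Inflow is split as \<open>q z * u' z x - p z * u z x = e z * u z x + q z * (u' z
    x - u z x)\<close>, and outflow likewise. The sign \<open>s x\<close> fits \<open>e x\<close>,
    so the outflow of the difference is exactly \<open>\<bar>e x\<bar> * u x z\<close>, while the
    inflow from \<open>z\<close> is merely at most \<open>\<bar>e z\<bar> * u z x\<close>.\<close>
  have bound: "s x * ((q z * u' z x - q x * u' x z) - (p z * u z x - p x * u x z))
      \<le> (\<bar>e z\<bar> * u z x - \<bar>e x\<bar> * u x z) + (q z * \<Delta> z x + q x * \<Delta> x z)"
    if x: "x \<in> S" and z: "z \<in> S - {x}" for x z
  proof -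
    have "s x * ((q z * u' z x - q x * u' x z) - (p z * u z x - p x * u x z))
      = s x * e z * u z x - (s x * e x) * u x z
        + s x * (q z * (u' z x - u z x)) - s x * (q x * (u' x z - u x z))"
      by (simp add: e_def algebra_simps)
    moreover have "s x * e z * u z x \<le> \<bar>e z\<bar> * u z x"
    proof (rule mult_right_mono)
      show "s x * e z \<le> \<bar>e z\<bar>"
        using abs_ge_self [of "s x * e z"] s(1) [OF x] by (simp add: abs_mult)
    qed (use u x z in auto)
    moreover have "s x * (q z * (u' z x - u z x)) \<le> q z * \<Delta> z x"
      using abs_ge_self [of "s x * (q z * (u' z x - u z x))"] s(1) [OF x] q [of z] z
      by (simp add: abs_mult \<Delta>_def)
    moreover have "- (s x * (q x * (u' x z - u x z))) \<le> q x * \<Delta> x z"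
      using abs_ge_minus_self [of "s x * (q x * (u' x z - u x z))"] s(1) [OF x] q [OF x]
      by (simp add: abs_mult \<Delta>_def)
    ultimately show ?thesis
      using s(2) [OF x] by (simp add: e_def)
  qed
  have "(\<Sum>x\<in>S. s x * ((\<Sum>z\<in>S - {x}. q z * u' z x - q x * u' x z)
                     - (\<Sum>z\<in>S - {x}. p z * u z x - p x * u x z)))
    = (\<Sum>x\<in>S. \<Sum>z\<in>S - {x}. s x * ((q z * u' z x - q x * u' x z) - (p z * u z x - p x * u x z)))"
    by (simp only: sum_subtractf [symmetric] sum_distrib_left)
  also have "\<dots> \<le> (\<Sum>x\<in>S. \<Sum>z\<in>S - {x}. (\<bar>e z\<bar> * u z x - \<bar>e x\<bar> * u x z) + (q z * \<Delta> z x + q x * \<Delta> x z))"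
    by (intro sum_mono bound)
  \<comment> \<open>Swapping the roles of \<open>x\<close> and \<open>z\<close> cancels the two sums
    with \<open>\<bar>e\<bar>\<close> and identifies the two error sums, whence the factor
    2.\<close>
  also have "\<dots> = 2 * (\<Sum>x\<in>S. \<Sum>z\<in>S - {x}. q x * \<Delta> x z)"
    using sum_off_diagonal_swap [OF assms(1), of "\<lambda>x z. \<bar>e x\<bar> * u x z"]
      sum_off_diagonal_swap [OF assms(1), of "\<lambda>x z. q x * \<Delta> x z"]
    by (simp add: sum.distrib sum_subtractf)
  finally show ?thesis
    by (simp add: sum_distrib_left \<Delta>_def)
qed

text \<open>Centring the loss at the midpoint of \<open>[0, B]\<close> halves its supremum bound,
  which supplies the 1/2 of the total variation; equal masses make the centring free of
  cost.\<close>

lemma sum_mult_le_add_tv: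
  fixes p q l :: "'s \<Rightarrow> real"
  assumes "\<And>x. x \<in> S \<Longrightarrow> 0 \<le> l x \<and> l x \<le> B" and "sum q S = sum p S"
  shows "(\<Sum>x\<in>S. q x * l x) \<le> (\<Sum>x\<in>S. p x * l x) + B * (1 / 2 * (\<Sum>x\<in>S. \<bar>q x - p x\<bar>))"
proof -
  have "(\<Sum>x\<in>S. q x * l x) - (\<Sum>x\<in>S. p x * l x)
      = (\<Sum>x\<in>S. (l x - B / 2) * (q x - p x)) + B / 2 * (sum q S - sum p S)"
    by (simp add: sum_distrib_left sum.distrib [symmetric] sum_subtractf [symmetric] algebra_simps)
  also have "\<dots> \<le> (\<Sum>x\<in>S. B / 2 * \<bar>q x - p x\<bar>)"
  proof -
    have "(l x - B / 2) * (q x - p x) \<le> B / 2 * \<bar>q x - p x\<bar>" if "x \<in> S" for x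
    proof -
      have "\<bar>l x - B / 2\<bar> \<le> B / 2"
        using assms(1) [OF that] by linarith
      then have "\<bar>l x - B / 2\<bar> * \<bar>q x - p x\<bar> \<le> B / 2 * \<bar>q x - p x\<bar>"
        by (intro mult_right_mono) auto
      then show ?thesis
        using abs_ge_self [of "(l x - B / 2) * (q x - p x)"] by (simp add: abs_mult)
    qed
    then show ?thesis using assms(2) by (simp add: sum_mono)
  qed
  finally show ?thesis by (simp add: sum_distrib_left)
qed

section \<open>Integration over time\<close>

text \<open>An infinite integral makes the claim trivial. A finite one makes the nonnegative
  \<open>G\<close> Lebesgue integrable, hence gauge integrable with the same value.\<close>

lemma absolutely_continuous_fun_increment_le_nn_integral:
  fixes f G :: "real \<Rightarrow> real"
  assumes "a \<le> b" and f: "absolutely_continuous_fun a b f"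
    and G: "G \<in> borel_measurable (lebesgue_on {a..b})" "\<And>t. t \<in> {a..b} \<Longrightarrow> 0 \<le> G t"
    and loc: "AE t in lebesgue. t \<in> {a..b} \<longrightarrow> (\<forall>e>0.
      \<exists>r>0. \<forall>v w. a \<le> v \<and> v \<le> t \<and> t \<le> w \<and> w \<le> b \<and> t - v < r \<and> w - t < r \<longrightarrow>
        f w - f v \<le> (G t + e) * (w - v))"
  shows "ennreal (f b - f a) \<le> (\<integral>\<^sup>+ t. ennreal (G t) \<partial>lebesgue_on {a..b})"
proof (cases "(\<integral>\<^sup>+ t. ennreal (G t) \<partial>lebesgue_on {a..b}) < \<infinity>")
  case True
  have int: "integrable (lebesgue_on {a..b}) G"
    by (rule integrableI_nonneg [OF G(1) _ True]) (auto intro!: AE_I2 G(2))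
  define P where "P t \<longleftrightarrow> (\<forall>e>0.
      \<exists>r>0. \<forall>v w. a \<le> v \<and> v \<le> t \<and> t \<le> w \<and> w \<le> b \<and> t - v < r \<and> w - t < r \<longrightarrow>
        f w - f v \<le> (G t + e) * (w - v))" for t
  have "AE t in lebesgue. t \<in> {a..b} \<longrightarrow> P t"
    using loc unfolding P_def .
  then obtain N where bad: "{t \<in> space lebesgue. \<not> (t \<in> {a..b} \<longrightarrow> P t)} \<subseteq> N"
    and "emeasure lebesgue N = 0" "N \<in> sets lebesgue"
    by (rule AE_E)
  then have N: "N \<in> null_sets lebesgue"
    by (intro null_setsI)
  have "f b - f a \<le> integral {a..b} G"
  proof (rule absolutely_continuous_fun_increment_le [OF \<open>a \<le> b\<close> f])
    show "negligible N" using N by (simp add: negligible_iff_null_sets)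
    show "G integrable_on {a..b}" by (rule integrable_on_lebesgue_on [OF int]) simp
    show "\<exists>r>0. \<forall>v w. a \<le> v \<and> v \<le> t \<and> t \<le> w \<and> w \<le> b \<and> t - v < r \<and> w - t < r \<longrightarrow>
        f w - f v \<le> (G t + e) * (w - v)" if "t \<in> {a..b} - N" "0 < e" for t e
    proof -
      have "P t" using that(1) bad by auto
      then show ?thesis using that(2) by (simp add: P_def)
    qed
  qed
  also have "integral {a..b} G = integral\<^sup>L (lebesgue_on {a..b}) G"
    by (rule lebesgue_integral_eq_integral [OF int, symmetric]) simp
  finally show ?thesis
    by (subst nn_integral_eq_integral [OF int]) (auto intro!: AE_I2 G(2) ennreal_leI)
next
  case False
  then show ?thesis by (simp add: not_less top_unique)
qed

lemma sigma_finite_lebesgue_on_Icc: "sigma_finite_measure (lebesgue_on {a..b::real})"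
  by (intro finite_measure.axioms(1) finite_measureI)
    (simp add: emeasure_restrict_space space_restrict_space emeasure_lborel_Icc_eq)

text \<open>By Tonelli, each \<open>s\<close> is counted for the times \<open>t\<close> in
  \<open>{s..1}\<close>, an interval of length \<open>1 - s\<close>.\<close>

lemma nn_integral_triangle:
  fixes g :: "real \<Rightarrow> ennreal"
  assumes g: "g \<in> borel_measurable (lebesgue_on {0..1})"
  shows "(\<integral>\<^sup>+ t. (\<integral>\<^sup>+ s. (if s \<le> t then g s else 0) \<partial>lebesgue_on {0..1}) \<partial>lebesgue_on {0..1})
    = (\<integral>\<^sup>+ s. ennreal (1 - s) * g s \<partial>lebesgue_on {0..1})"
proof -
  let ?M = "lebesgue_on {0..1::real}"
  interpret pair_sigma_finite ?M ?M
    by (intro pair_sigma_finite.intro sigma_finite_lebesgue_on_Icc)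
  \<comment> \<open>The domain carries the Lebesgue sigma-algebra and the target the Borel one, so
    this is not the trivial measurability of an identity. It makes the triangle
    \<open>s \<le> t\<close> measurable in the product.\<close>
  have id: "(\<lambda>x. x) \<in> borel_measurable ?M"
    by (rule continuous_imp_measurable_on_sets_lebesgue) auto
  have [measurable]: "fst \<in> borel_measurable (?M \<Otimes>\<^sub>M ?M)"
    by (rule measurable_compose [OF measurable_fst id])
  have [measurable]: "snd \<in> borel_measurable (?M \<Otimes>\<^sub>M ?M)"
    by (rule measurable_compose [OF measurable_snd id])
  have [measurable]: "(\<lambda>w. g (fst w)) \<in> borel_measurable (?M \<Otimes>\<^sub>M ?M)"
    by (rule measurable_compose [OF measurable_fst g])
  have "(\<lambda>w. if fst w \<le> snd w then g (fst w) else 0) \<in> borel_measurable (?M \<Otimes>\<^sub>M ?M)"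
    by measurable
  then have "case_prod (\<lambda>s t. if s \<le> t then g s else 0) \<in> borel_measurable (?M \<Otimes>\<^sub>M ?M)"
    by (simp add: split_beta)
  then have "(\<integral>\<^sup>+ t. (\<integral>\<^sup>+ s. (if s \<le> t then g s else 0) \<partial>?M) \<partial>?M)
      = (\<integral>\<^sup>+ s. (\<integral>\<^sup>+ t. (if s \<le> t then g s else 0) \<partial>?M) \<partial>?M)"
    by (rule Fubini')
  also have "\<dots> = (\<integral>\<^sup>+ s. ennreal (1 - s) * g s \<partial>?M)"
  proof (rule nn_integral_cong)
    fix s assume "s \<in> space ?M"
    then have s: "0 \<le> s" "s \<le> 1" by auto
    have "(\<integral>\<^sup>+ t. (if s \<le> t then g s else 0) \<partial>?M) = (\<integral>\<^sup>+ t. g s * indicator {s..1} t \<partial>?M)"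
      by (rule nn_integral_cong) (auto simp: indicator_def)
    also have "\<dots> = g s * emeasure ?M {s..1}"
      using s by (intro nn_integral_cmult_indicator) (auto simp: sets_restrict_space_iff)
    also have "emeasure ?M {s..1} = ennreal (1 - s)"
      using s by (subst emeasure_restrict_space) auto
    finally show "(\<integral>\<^sup>+ t. (if s \<le> t then g s else 0) \<partial>?M) = ennreal (1 - s) * g s"
      by (simp add: mult.commute)
  qed
  finally show ?thesis .
qed

section \<open>Occupancy integrals as time integrals of finite sums\<close>

text \<open>The second coordinate takes only finitely many values, so measurability may be checked
  slice by slice.\<close>

lemma borel_measurable_reference_measure:
  assumes "finite S" and "\<And>x. x \<in> S \<Longrightarrow> (\<lambda>t. f (t, x)) \<in> borel_measurable (lebesgue_on {0..1})"
  shows "f \<in> borel_measurable (reference_measure S)"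
proof -
  have "(\<lambda>w. (\<lambda>x w. f (fst w, x)) (snd w) w) \<in> borel_measurable (lebesgue_on {0..1} \<Otimes>\<^sub>M count_space S)"
  proof (rule measurable_compose_countable' [where I = S])
    show "(\<lambda>w. f (fst w, x)) \<in> borel_measurable (lebesgue_on {0..1} \<Otimes>\<^sub>M count_space S)" if "x \<in> S" for x
      by (rule measurable_compose [OF measurable_fst assms(2) [OF that]])
  qed (use assms(1) in \<open>auto intro: countable_finite\<close>)
  then show ?thesis by (simp add: reference_measure_def)
qed

lemma nn_integral_reference_measure:
  assumes "finite S" and "f \<in> borel_measurable (reference_measure S)"
  shows "(\<integral>\<^sup>+ w. f w \<partial>reference_measure S) = (\<integral>\<^sup>+ t. (\<Sum>x\<in>S. f (t, x)) \<partial>lebesgue_on {0..1})"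
proof -
  interpret sigma_finite_measure "count_space S"
    by (rule sigma_finite_measure_count_space_finite [OF assms(1)])
  show ?thesis
    using nn_integral_fst [OF assms(2) [unfolded reference_measure_def]]
    by (simp add: reference_measure_def nn_integral_count_space_finite [OF assms(1)])
qed

lemma borel_measurable_master_equation:
  assumes "master_equation S p u" "x \<in> S"
  shows "(\<lambda>t. pmf (p t) x) \<in> borel_measurable (lebesgue_on {0..1})"
  using assms unfolding master_equation_def
  by (intro continuous_imp_measurable_on_sets_lebesgue absolutely_continuous_fun_imp_continuous_on) auto

lemma borel_measurable_occupancy_density:
  assumes "finite S" "master_equation S p u"
  shows "occupancy_density p \<in> borel_measurable (reference_measure S)"
proof (rule borel_measurable_reference_measure [OF assms(1)])
  fix x assume "x \<in> S"
  then have "(\<lambda>t. pmf (p t) x) \<in> borel_measurable (lebesgue_on {0..1})"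
    by (rule borel_measurable_master_equation [OF assms(2)])
  then show "(\<lambda>t. occupancy_density p (t, x)) \<in> borel_measurable (lebesgue_on {0..1})"
    by (rule measurable_cong [THEN iffD1, rotated]) (simp add: occupancy_density_def)
qed

text \<open>The indicator in the density is 1 on the time interval, and nonnegativity lets
  \<open>ennreal\<close> move outside products and sums. The integrand becomes a real expectation at
  a fixed time, as \<open>sum_mult_le_add_tv\<close> expects.\<close>

lemma nn_integral_occupancy:
  assumes "finite S" "master_equation S p u" and l: "l \<in> borel_measurable (reference_measure S)"
    and l_nonneg: "\<And>t x. t \<in> {0..1} \<Longrightarrow> x \<in> S \<Longrightarrow> 0 \<le> l (t, x)"
  shows "(\<integral>\<^sup>+ w. ennreal (l w) \<partial>occupancy S p)
    = (\<integral>\<^sup>+ t. ennreal (\<Sum>x\<in>S. pmf (p t) x * l (t, x)) \<partial>lebesgue_on {0..1})"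
proof -
  note [measurable] = borel_measurable_occupancy_density [OF assms(1,2)] l
  have "(\<integral>\<^sup>+ w. ennreal (l w) \<partial>occupancy S p)
      = (\<integral>\<^sup>+ w. ennreal (occupancy_density p w) * ennreal (l w) \<partial>reference_measure S)"
    unfolding occupancy_def by (intro nn_integral_density) measurable
  also have "\<dots> = (\<integral>\<^sup>+ t. (\<Sum>x\<in>S. ennreal (occupancy_density p (t, x)) * ennreal (l (t, x))) \<partial>lebesgue_on {0..1})"
    by (intro nn_integral_reference_measure assms(1)) measurable
  also have "\<dots> = (\<integral>\<^sup>+ t. ennreal (\<Sum>x\<in>S. pmf (p t) x * l (t, x)) \<partial>lebesgue_on {0..1})"
  proof (rule nn_integral_cong)
    fix t :: real assume "t \<in> space (lebesgue_on {0..1})"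
    then have t: "t \<in> {0..1}" by simp
    have "(\<Sum>x\<in>S. ennreal (occupancy_density p (t, x)) * ennreal (l (t, x)))
        = (\<Sum>x\<in>S. ennreal (pmf (p t) x * l (t, x)))"
      using t l_nonneg [OF t] by (intro sum.cong) (auto simp: occupancy_density_def ennreal_mult)
    also have "\<dots> = ennreal (\<Sum>x\<in>S. pmf (p t) x * l (t, x))"
      using l_nonneg [OF t] by (intro sum_ennreal) simp
    finally show "(\<Sum>x\<in>S. ennreal (occupancy_density p (t, x)) * ennreal (l (t, x)))
        = ennreal (\<Sum>x\<in>S. pmf (p t) x * l (t, x))" .
  qed
  finally show ?thesis .
qed

lemma tv_norm_occupancy_density:
  assumes "finite S" "master_equation S p u" "master_equation S q u'"
  shows "tv_norm (reference_measure S) (\<lambda>w. occupancy_density q w - occupancy_density p w)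
    = (\<integral>\<^sup>+ t. ennreal (1 / 2 * (\<Sum>x\<in>S. \<bar>pmf (q t) x - pmf (p t) x\<bar>)) \<partial>lebesgue_on {0..1})"
proof -
  note [measurable] = borel_measurable_occupancy_density [OF assms(1,2)]
    borel_measurable_occupancy_density [OF assms(1,3)]
  let ?d = "\<lambda>w. ennreal \<bar>occupancy_density q w - occupancy_density p w\<bar>"
  have "tv_norm (reference_measure S) (\<lambda>w. occupancy_density q w - occupancy_density p w)
      = (\<integral>\<^sup>+ w. ennreal (1 / 2) * ?d w \<partial>reference_measure S)"
    unfolding tv_norm_def by (intro nn_integral_cmult [symmetric]) measurable
  also have "\<dots> = (\<integral>\<^sup>+ t. (\<Sum>x\<in>S. ennreal (1 / 2) * ?d (t, x)) \<partial>lebesgue_on {0..1})"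
    by (intro nn_integral_reference_measure assms(1)) measurable
  also have "\<dots> = (\<integral>\<^sup>+ t. ennreal (1 / 2 * (\<Sum>x\<in>S. \<bar>pmf (q t) x - pmf (p t) x\<bar>)) \<partial>lebesgue_on {0..1})"
  proof (rule nn_integral_cong)
    fix t :: real assume "t \<in> space (lebesgue_on {0..1})"
    then have "?d (t, x) = ennreal \<bar>pmf (q t) x - pmf (p t) x\<bar>" for x
      by (simp add: occupancy_density_def)
    then have "(\<Sum>x\<in>S. ennreal (1 / 2) * ?d (t, x))
        = ennreal (1 / 2) * (\<Sum>x\<in>S. ennreal \<bar>pmf (q t) x - pmf (p t) x\<bar>)"
      by (simp only: sum_distrib_left)
    also have "\<dots> = ennreal (1 / 2) * ennreal (\<Sum>x\<in>S. \<bar>pmf (q t) x - pmf (p t) x\<bar>)"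
      by (subst sum_ennreal) simp_all
    also have "\<dots> = ennreal (1 / 2 * (\<Sum>x\<in>S. \<bar>pmf (q t) x - pmf (p t) x\<bar>))"
      by (intro ennreal_mult [symmetric] sum_nonneg) simp_all
    finally show "(\<Sum>x\<in>S. ennreal (1 / 2) * ?d (t, x))
        = ennreal (1 / 2 * (\<Sum>x\<in>S. \<bar>pmf (q t) x - pmf (p t) x\<bar>))" .
  qed
  finally show ?thesis .
qed

section \<open>Growth of the total variation distance\<close>

text \<open>The distance starts at 0, so its value at \<open>t\<close> is its increment over
  \<open>{0..t}\<close>. The integral is written over \<open>{0..1}\<close> with a cut-off at
  \<open>t\<close>, the form in which \<open>nn_integral_triangle\<close> exchanges the
  order.\<close>

lemma tv_distance_le:
  assumes "finite S" and "p 0 = q 0"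
    and u: "velocity_field S u" and u': "velocity_field S u'"
    and mp: "master_equation S p u" and mq: "master_equation S q u'"
    and t: "t \<in> {0..1}"
  shows "ennreal (1 / 2 * (\<Sum>x\<in>S. \<bar>pmf (q t) x - pmf (p t) x\<bar>))
    \<le> (\<integral>\<^sup>+ s. (if s \<le> t then ennreal (\<Sum>x\<in>S. pmf (q s) x * (\<Sum>z\<in>S - {x}. \<bar>u' s x z - u s x z\<bar>)) else 0)
        \<partial>lebesgue_on {0..1})"
proof -
  define T where "T s = 1 / 2 * (\<Sum>x\<in>S. \<bar>pmf (q s) x - pmf (p s) x\<bar>)" for s
  define g where "g s = (\<Sum>x\<in>S. pmf (q s) x * (\<Sum>z\<in>S - {x}. \<bar>u' s x z - u s x z\<bar>))" for s
  have acp: "absolutely_continuous_fun 0 1 (\<lambda>s. pmf (p s) x)"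
    and acq: "absolutely_continuous_fun 0 1 (\<lambda>s. pmf (q s) x)" if "x \<in> S" for x
    using mp mq that by (auto simp: master_equation_def)
  have acT: "absolutely_continuous_fun 0 1 T"
    unfolding T_def sum_distrib_left
  proof (intro absolutely_continuous_fun_sum assms(1))
    fix x assume "x \<in> S"
    from acq [OF this] acp [OF this]
    show "absolutely_continuous_fun 0 1 (\<lambda>s. 1 / 2 * \<bar>pmf (q s) x - pmf (p s) x\<bar>)"
    proof (rule absolutely_continuous_fun_le_add)
      have "\<bar>1 / 2 * \<bar>a - b\<bar> - 1 / 2 * \<bar>c - d\<bar>\<bar> \<le> \<bar>a - c\<bar> + \<bar>b - d\<bar>" for a b c d :: real
      proof -
        have "\<bar>\<bar>a - b\<bar> - \<bar>c - d\<bar>\<bar> \<le> \<bar>a - c\<bar> + \<bar>b - d\<bar>"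
          by linarith
        moreover have "\<bar>1 / 2 * X - 1 / 2 * Y\<bar> \<le> \<bar>X - Y\<bar>" for X Y :: real
          by linarith
        ultimately show ?thesis by (rule order_trans [rotated])
      qed
      then show "\<bar>1 / 2 * \<bar>pmf (q t) x - pmf (p t) x\<bar> - 1 / 2 * \<bar>pmf (q s) x - pmf (p s) x\<bar>\<bar>
        \<le> \<bar>pmf (q t) x - pmf (q s) x\<bar> + \<bar>pmf (p t) x - pmf (p s) x\<bar>" for s t .
    qed
  qed
  have g_meas: "g \<in> borel_measurable (lebesgue_on {0..1})"
    unfolding g_def using u u' unfolding velocity_field_def
    by (intro borel_measurable_sum borel_measurable_times borel_measurable_abs borel_measurable_diff
        borel_measurable_master_equation [OF mq]) auto
  have g_nonneg: "0 \<le> g s" for s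
    unfolding g_def by (intro sum_nonneg mult_nonneg_nonneg) auto
  define e where "e x s = pmf (q s) x - pmf (p s) x" for x s
  define D where "D x s = (\<Sum>z\<in>S - {x}. pmf (q s) z * u' s z x - pmf (q s) x * u' s x z)
      - (\<Sum>z\<in>S - {x}. pmf (p s) z * u s z x - pmf (p s) x * u s x z)" for x s
  have "AE s in lebesgue_on {0..1}. \<forall>x\<in>S. (e x has_real_derivative D x s) (at s within {0..1})"
    using mp mq unfolding master_equation_def e_def [abs_def] D_def
    by (auto elim!: eventually_elim2 intro!: DERIV_diff)
  then have deriv: "AE s in lebesgue. s \<in> {0..1} \<longrightarrow>
      (\<forall>x\<in>S. (e x has_real_derivative D x s) (at s within {0..1}))"
    by (subst (asm) AE_restrict_space_iff) auto
  have loc: "\<exists>r>0. \<forall>v w. 0 \<le> v \<and> v \<le> s \<and> s \<le> w \<and> w \<le> 1 \<and> s - v < r \<and> w - s < r \<longrightarrow>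
        T w - T v \<le> (g s + \<epsilon>) * (w - v)"
    if s: "s \<in> {0..1}" and "0 < \<epsilon>"
      and der: "\<forall>x\<in>S. (e x has_real_derivative D x s) (at s within {0..1})" for s \<epsilon>
  proof -
    \<comment> \<open>Where \<open>e\<close> vanishes, \<open>\<bar>e\<bar>\<close> need not be differentiable; the sign of \<open>D\<close> still gives a local bound.\<close>
    define \<sigma> :: "_ \<Rightarrow> real" where
      "\<sigma> x = (if 0 < e x s \<or> e x s = 0 \<and> 0 \<le> D x s then 1 else - 1)" for x
    have \<sigma>: "\<bar>\<sigma> x\<bar> = 1" "\<sigma> x * e x s = \<bar>e x s\<bar>" "e x s = 0 \<Longrightarrow> \<sigma> x * D x s = \<bar>D x s\<bar>" for x
      by (auto simp: \<sigma>_def)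
    have sum_le: "(\<Sum>x\<in>S. \<sigma> x * D x s) \<le> 2 * g s"
      unfolding D_def g_def
    proof (rule master_equation_sign_le [OF assms(1)])
      show "0 \<le> u s x z" if "x \<in> S" "z \<in> S" "z \<noteq> x" for x z
        using u s that by (auto simp: velocity_field_def)
    qed (use \<sigma> in \<open>auto simp: e_def\<close>)
    \<comment> \<open>The sum is \<open>2 * T\<close>, so the slack is doubled and halving leaves
      the slope \<open>g s + \<epsilon>\<close>. The sign \<open>\<sigma>\<close> belongs to the
      fixed time \<open>s\<close>, hence the slopes enter as constant functions.\<close>
    have "\<exists>r>0. \<forall>v w. 0 \<le> v \<and> v \<le> s \<and> s \<le> w \<and> w \<le> 1 \<and> s - v < r \<and> w - s < r \<longrightarrow>
        (\<Sum>x\<in>S. \<bar>e x w\<bar>) - (\<Sum>x\<in>S. \<bar>e x v\<bar>) \<le> ((\<Sum>x\<in>S. \<sigma> x * D x s) + 2 * \<epsilon>) * (w - v)"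
    proof (rule sum_local_increment_le [where f = "\<lambda>x s. \<bar>e x s\<bar>" and D = "\<lambda>x _. \<sigma> x * D x s"])
      fix x and \<epsilon>' :: real assume "x \<in> S" "0 < \<epsilon>'"
      have "(e x has_real_derivative D x s) (at s within {0..1})"
        using der \<open>x \<in> S\<close> by blast
      then show "\<exists>r>0. \<forall>v w. 0 \<le> v \<and> v \<le> s \<and> s \<le> w \<and> w \<le> 1 \<and> s - v < r \<and> w - s < r \<longrightarrow>
        \<bar>e x w\<bar> - \<bar>e x v\<bar> \<le> (\<sigma> x * D x s + \<epsilon>') * (w - v)"
        by (rule abs_local_increment_le) (use \<sigma> \<open>0 < \<epsilon>'\<close> in auto)
    qed (use assms(1) \<open>0 < \<epsilon>\<close> in auto)
    then obtain r where "0 < r" and r: "\<And>v w. 0 \<le> v \<and> v \<le> s \<and> s \<le> w \<and> w \<le> 1 \<and> s - v < r \<and> w - s < r \<Longrightarrow>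
        (\<Sum>x\<in>S. \<bar>e x w\<bar>) - (\<Sum>x\<in>S. \<bar>e x v\<bar>) \<le> ((\<Sum>x\<in>S. \<sigma> x * D x s) + 2 * \<epsilon>) * (w - v)"
      by blast
    show ?thesis
    proof (intro exI [of _ r] conjI allI impI \<open>0 < r\<close>)
      fix v w assume vw: "0 \<le> v \<and> v \<le> s \<and> s \<le> w \<and> w \<le> 1 \<and> s - v < r \<and> w - s < r"
      have "2 * (T w - T v) = (\<Sum>x\<in>S. \<bar>e x w\<bar>) - (\<Sum>x\<in>S. \<bar>e x v\<bar>)"
        by (simp add: T_def e_def)
      also have "\<dots> \<le> ((\<Sum>x\<in>S. \<sigma> x * D x s) + 2 * \<epsilon>) * (w - v)"
        by (rule r [OF vw])
      also have "\<dots> \<le> (2 * g s + 2 * \<epsilon>) * (w - v)"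
        using vw sum_le by (intro mult_right_mono) auto
      also have "\<dots> = 2 * ((g s + \<epsilon>) * (w - v))"
        by (simp add: algebra_simps)
      finally show "T w - T v \<le> (g s + \<epsilon>) * (w - v)" by simp
    qed
  qed
  have "ennreal (T t - T 0) \<le> (\<integral>\<^sup>+ s. ennreal (g s) \<partial>lebesgue_on {0..t})"
  proof (rule absolutely_continuous_fun_increment_le_nn_integral)
    show "absolutely_continuous_fun 0 t T"
      using t by (intro absolutely_continuous_fun_subinterval [OF acT]) auto
    show "g \<in> borel_measurable (lebesgue_on {0..t})"
      using t by (intro measurable_restrict_mono [OF g_meas]) auto
    show "AE s in lebesgue. s \<in> {0..t} \<longrightarrow> (\<forall>\<epsilon>>0.
      \<exists>r>0. \<forall>v w. 0 \<le> v \<and> v \<le> s \<and> s \<le> w \<and> w \<le> t \<and> s - v < r \<and> w - s < r \<longrightarrow>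
        T w - T v \<le> (g s + \<epsilon>) * (w - v))"
    proof (rule eventually_mono [OF deriv], intro impI allI)
      fix s \<epsilon> :: real
      assume der: "s \<in> {0..1} \<longrightarrow> (\<forall>x\<in>S. (e x has_real_derivative D x s) (at s within {0..1}))"
        and s: "s \<in> {0..t}" and "0 < \<epsilon>"
      have s1: "s \<in> {0..1}" using s t by auto
      obtain r where "0 < r" and r: "\<And>v w. 0 \<le> v \<and> v \<le> s \<and> s \<le> w \<and> w \<le> 1 \<and> s - v < r \<and> w - s < r \<Longrightarrow>
        T w - T v \<le> (g s + \<epsilon>) * (w - v)"
        using loc [OF s1 \<open>0 < \<epsilon>\<close> der [THEN HOL.mp, OF s1]] by blast
      show "\<exists>r>0. \<forall>v w. 0 \<le> v \<and> v \<le> s \<and> s \<le> w \<and> w \<le> t \<and> s - v < r \<and> w - s < r \<longrightarrow>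
        T w - T v \<le> (g s + \<epsilon>) * (w - v)"
        using t by (intro exI [of _ r] conjI allI impI \<open>0 < r\<close> r) auto
    qed
  qed (use t g_nonneg in auto)
  moreover have "T 0 = 0" using \<open>p 0 = q 0\<close> by (simp add: T_def)
  moreover have "(\<integral>\<^sup>+ s. ennreal (g s) \<partial>lebesgue_on {0..t})
      = (\<integral>\<^sup>+ s. (if s \<le> t then ennreal (g s) else 0) \<partial>lebesgue_on {0..1})"
    using t by (simp add: nn_integral_restrict_space) (auto intro!: nn_integral_cong simp: indicator_def)
  ultimately have "ennreal (T t) \<le> (\<integral>\<^sup>+ s. (if s \<le> t then ennreal (g s) else 0) \<partial>lebesgue_on {0..1})"
    by simp
  then show ?thesis unfolding T_def g_def .
qed

section \<open>The two bounds on the expected loss\<close>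

theorem theorem1:
  fixes V :: "'v set" and L :: nat and S :: "(nat \<Rightarrow> 'v) set"
    and p q :: "real \<Rightarrow> (nat \<Rightarrow> 'v) pmf"
    and u u\<theta> \<Delta> :: "real \<Rightarrow> (nat \<Rightarrow> 'v) \<Rightarrow> (nat \<Rightarrow> 'v) \<Rightarrow> real"
    and \<mu>_train \<mu>_gen :: "(real \<times> (nat \<Rightarrow> 'v)) measure"
    and B :: real and loss :: "real \<times> (nat \<Rightarrow> 'v) \<Rightarrow> real"
  assumes "finite V" and "V \<noteq> {}" and "1 \<le> L"
    and S_def: "S = state_space V L"
    and "\<And>t. t \<in> {0..1} \<Longrightarrow> set_pmf (p t) \<subseteq> S"
    and "\<And>t. t \<in> {0..1} \<Longrightarrow> set_pmf (q t) \<subseteq> S"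
    and "p 0 = q 0"
    and "velocity_field S u" and "velocity_field S u\<theta>"
    and "master_equation S p u" and "master_equation S q u\<theta>"
    and Delta_def: "\<Delta> = velocity_error u\<theta> u"
    and mu_train_def: "\<mu>_train = occupancy S p"
    and mu_gen_def: "\<mu>_gen = occupancy S q"
    and "0 \<le> B"
    and "loss \<in> borel_measurable (reference_measure S)"
    and "\<And>t x. t \<in> {0..1} \<Longrightarrow> x \<in> S \<Longrightarrow> 0 \<le> loss (t, x) \<and> loss (t, x) \<le> B"
  shows "((\<integral>\<^sup>+ w. ennreal (loss w) \<partial>\<mu>_gen)
           \<le> (\<integral>\<^sup>+ w. ennreal (loss w) \<partial>\<mu>_train)
             + ennreal B * tv_norm (reference_measure S)
                 (\<lambda>w. occupancy_density q w - occupancy_density p w)) \<and>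
         ((\<integral>\<^sup>+ w. ennreal (loss w) \<partial>\<mu>_gen)
           \<le> (\<integral>\<^sup>+ w. ennreal (loss w) \<partial>\<mu>_train)
             + ennreal B *
               (\<integral>\<^sup>+ t. ennreal ((1 - t) *
                    measure_pmf.expectation (q t) (\<lambda>x. \<Sum>z\<in>S - {x}. \<bar>\<Delta> t x z\<bar>))
                  \<partial>lebesgue_on {0..1}))"
proof -
  have fin: "finite S"
    using \<open>finite V\<close> unfolding S_def state_space_def by (intro finite_PiE) auto
  note mp = \<open>master_equation S p u\<close> and mq = \<open>master_equation S q u\<theta>\<close>
  note loss_bounds = \<open>\<And>t x. t \<in> {0..1} \<Longrightarrow> x \<in> S \<Longrightarrow> 0 \<le> loss (t, x) \<and> loss (t, x) \<le> B\<close>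
  define T where "T t = 1 / 2 * (\<Sum>x\<in>S. \<bar>pmf (q t) x - pmf (p t) x\<bar>)" for t
  define g where "g t = (\<Sum>x\<in>S. pmf (q t) x * (\<Sum>z\<in>S - {x}. \<bar>u\<theta> t x z - u t x z\<bar>))" for t
  note [measurable] = borel_measurable_master_equation [OF mp] borel_measurable_master_equation [OF mq]
  have T_nonneg: "0 \<le> T t" for t
    by (simp add: T_def sum_nonneg)
  have T_meas: "T \<in> borel_measurable (lebesgue_on {0..1})"
    unfolding T_def by measurable
  have loss_meas: "(\<lambda>t. loss (t, x)) \<in> borel_measurable (lebesgue_on {0..1})" if "x \<in> S" for x
  proof (rule measurable_compose [OF _ \<open>loss \<in> borel_measurable (reference_measure S)\<close>])
    show "(\<lambda>t. (t, x)) \<in> lebesgue_on {0..1} \<rightarrow>\<^sub>M reference_measure S"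
      unfolding reference_measure_def using that by (intro measurable_Pair) auto
  qed
  have tv: "tv_norm (reference_measure S) (\<lambda>w. occupancy_density q w - occupancy_density p w)
      = (\<integral>\<^sup>+ t. ennreal (T t) \<partial>lebesgue_on {0..1})"
    unfolding T_def by (rule tv_norm_occupancy_density [OF fin mp mq])
  \<comment> \<open>With the time integral of \<open>T\<close> on the right, this serves both
    claims: by \<open>tv\<close> that integral is the total variation norm, and for the second claim
    it is only enlarged.\<close>
  have first: "(\<integral>\<^sup>+ w. ennreal (loss w) \<partial>\<mu>_gen)
      \<le> (\<integral>\<^sup>+ w. ennreal (loss w) \<partial>\<mu>_train) + ennreal B * (\<integral>\<^sup>+ t. ennreal (T t) \<partial>lebesgue_on {0..1})"
  proof -
    have "(\<integral>\<^sup>+ w. ennreal (loss w) \<partial>\<mu>_gen)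
        = (\<integral>\<^sup>+ t. ennreal (\<Sum>x\<in>S. pmf (q t) x * loss (t, x)) \<partial>lebesgue_on {0..1})"
      unfolding mu_gen_def
      by (rule nn_integral_occupancy [OF fin mq])
        (use \<open>loss \<in> borel_measurable (reference_measure S)\<close> loss_bounds in auto)
    also have "\<dots> \<le> (\<integral>\<^sup>+ t. ennreal (\<Sum>x\<in>S. pmf (p t) x * loss (t, x)) + ennreal B * ennreal (T t)
        \<partial>lebesgue_on {0..1})"
    proof (rule nn_integral_mono)
      fix t :: real assume "t \<in> space (lebesgue_on {0..1})"
      then have t: "t \<in> {0..1}" by simp
      \<comment> \<open>Since the supports lie in \<open>S\<close>, both distributions have mass 1
        on it, which is the equality of masses behind the centring of the loss.\<close>
      have "sum (pmf (q t)) S = 1" "sum (pmf (p t)) S = 1"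
        using \<open>\<And>t. t \<in> {0..1} \<Longrightarrow> set_pmf (q t) \<subseteq> S\<close> [OF t]
          \<open>\<And>t. t \<in> {0..1} \<Longrightarrow> set_pmf (p t) \<subseteq> S\<close> [OF t] by (auto intro: sum_pmf_eq_1 [OF fin])
      then have "(\<Sum>x\<in>S. pmf (q t) x * loss (t, x)) \<le> (\<Sum>x\<in>S. pmf (p t) x * loss (t, x)) + B * T t"
        unfolding T_def using loss_bounds [OF t] by (intro sum_mult_le_add_tv) auto
      then have "ennreal (\<Sum>x\<in>S. pmf (q t) x * loss (t, x))
          \<le> ennreal ((\<Sum>x\<in>S. pmf (p t) x * loss (t, x)) + B * T t)"
        by (rule ennreal_leI)
      also have "\<dots> = ennreal (\<Sum>x\<in>S. pmf (p t) x * loss (t, x)) + ennreal (B * T t)"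
        using loss_bounds [OF t] \<open>0 \<le> B\<close> T_nonneg by (intro ennreal_plus sum_nonneg) auto
      also have "ennreal (B * T t) = ennreal B * ennreal (T t)"
        using \<open>0 \<le> B\<close> T_nonneg by (rule ennreal_mult)
      finally show "ennreal (\<Sum>x\<in>S. pmf (q t) x * loss (t, x))
          \<le> ennreal (\<Sum>x\<in>S. pmf (p t) x * loss (t, x)) + ennreal B * ennreal (T t)" .
    qed
    also have "\<dots> = (\<integral>\<^sup>+ t. ennreal (\<Sum>x\<in>S. pmf (p t) x * loss (t, x)) \<partial>lebesgue_on {0..1})
        + (\<integral>\<^sup>+ t. ennreal B * ennreal (T t) \<partial>lebesgue_on {0..1})"
      by (rule nn_integral_add) (use T_meas loss_meas in measurable)
    also have "(\<integral>\<^sup>+ t. ennreal B * ennreal (T t) \<partial>lebesgue_on {0..1})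
        = ennreal B * (\<integral>\<^sup>+ t. ennreal (T t) \<partial>lebesgue_on {0..1})"
      by (rule nn_integral_cmult) (use T_meas in measurable)
    also have "(\<integral>\<^sup>+ t. ennreal (\<Sum>x\<in>S. pmf (p t) x * loss (t, x)) \<partial>lebesgue_on {0..1})
        = (\<integral>\<^sup>+ w. ennreal (loss w) \<partial>\<mu>_train)"
      unfolding mu_train_def
      by (rule nn_integral_occupancy [OF fin mp, symmetric])
        (use \<open>loss \<in> borel_measurable (reference_measure S)\<close> loss_bounds in auto)
    finally show ?thesis .
  qed
  have g_meas: "g \<in> borel_measurable (lebesgue_on {0..1})"
    unfolding g_def
    using \<open>velocity_field S u\<close> \<open>velocity_field S u\<theta>\<close> unfolding velocity_field_def
    by (intro borel_measurable_sum borel_measurable_times borel_measurable_abs borel_measurable_diff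
        borel_measurable_master_equation [OF mq]) auto
  have "(\<integral>\<^sup>+ t. ennreal (T t) \<partial>lebesgue_on {0..1})
      \<le> (\<integral>\<^sup>+ t. (\<integral>\<^sup>+ s. (if s \<le> t then ennreal (g s) else 0) \<partial>lebesgue_on {0..1}) \<partial>lebesgue_on {0..1})"
    unfolding T_def g_def
    by (intro nn_integral_mono tv_distance_le [OF fin \<open>p 0 = q 0\<close> \<open>velocity_field S u\<close>
          \<open>velocity_field S u\<theta>\<close> mp mq]) simp
  also have "\<dots> = (\<integral>\<^sup>+ t. ennreal (1 - t) * ennreal (g t) \<partial>lebesgue_on {0..1})"
    by (rule nn_integral_triangle) (use g_meas in measurable)
  also have "\<dots> = (\<integral>\<^sup>+ t. ennreal ((1 - t) *
      measure_pmf.expectation (q t) (\<lambda>x. \<Sum>z\<in>S - {x}. \<bar>\<Delta> t x z\<bar>)) \<partial>lebesgue_on {0..1})"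
  proof (rule nn_integral_cong)
    fix t :: real assume "t \<in> space (lebesgue_on {0..1})"
    then have t: "t \<in> {0..1}" by simp
    have "measure_pmf.expectation (q t) (\<lambda>x. \<Sum>z\<in>S - {x}. \<bar>\<Delta> t x z\<bar>) = g t"
      using \<open>\<And>t. t \<in> {0..1} \<Longrightarrow> set_pmf (q t) \<subseteq> S\<close> [OF t]
      by (subst integral_measure_pmf [OF fin]) (auto simp: g_def Delta_def velocity_error_def)
    moreover have "0 \<le> g t"
      unfolding g_def by (intro sum_nonneg mult_nonneg_nonneg) auto
    ultimately show "ennreal (1 - t) * ennreal (g t) = ennreal ((1 - t) *
      measure_pmf.expectation (q t) (\<lambda>x. \<Sum>z\<in>S - {x}. \<bar>\<Delta> t x z\<bar>))"
      using t by (simp add: ennreal_mult)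
  qed
  \<comment> \<open>In \<open>ennreal\<close>, \<open>0 * \<infinity> = 0\<close>, so
    \<open>B = 0\<close> with an infinite error integral is covered too.\<close>
  finally have "ennreal B * (\<integral>\<^sup>+ t. ennreal (T t) \<partial>lebesgue_on {0..1})
      \<le> ennreal B * (\<integral>\<^sup>+ t. ennreal ((1 - t) *
      measure_pmf.expectation (q t) (\<lambda>x. \<Sum>z\<in>S - {x}. \<bar>\<Delta> t x z\<bar>)) \<partial>lebesgue_on {0..1})"
    by (rule mult_left_mono) simp
  with first show ?thesis
    unfolding tv by (auto intro: order_trans add_left_mono)
qed

end
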